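(* In the region $|x|<\sqrt{2n}$, the Hermite polynomials have the asymptotic representation (writing $x=\sqrt{2n}\sin(\theta)$) $$H_{n}\left[\sqrt{2n}\sin(\theta)\right]\sim\sqrt{\frac{2}{\cos(\theta)}}\exp\left\{\frac{n}{2}\left[\ln(2n)-\cos(2\theta)\right]\right\}\cos\left\{n\left[\frac{1}{2}\sin(2\theta)+\theta-\frac{\pi}{2}\right]+\frac{\theta}{2}\right\},\quad n\to\infty,$$ with $-\frac{\pi}{2}<\theta<\frac{\pi}{2}$.
   Context: $H_n$ denotes the $n$-th (physicists') Hermite polynomial, $H_{n}(x)=(-1)^{n}e^{x^{2}}\frac{d^{n}}{dx^{n}}e^{-x^{2}}$, $n=0,1,2,\ldots$. The symbol $\sim$ denotes asymptotic approximation as $n\to\infty$. *)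

theory Defs
  imports "HOL-Analysis.Analysis" "HOL-Library.Landau_Symbols"
begin

definition hermite :: "nat \<Rightarrow> real \<Rightarrow> real" where
  "hermite n x = (- 1) ^ n * exp (x ^ 2) * (deriv ^^ n) (\<lambda>t. exp (- (t ^ 2))) x"

(* In the asymptotic formula for hermite n (sqrt (2 * n) * sin \<theta>), with \<theta> fixed, the cosine factor can vanish or be arbitrarily small for infinitely many n, so the quotient of
   both sides need not tend to 1.  As usual for oscillatory asymptotics, "~" means that the
   difference is negligible relative to the amplitude, i.e. H_n = amplitude * (cos(phase) + o(1)). *)

end

theory Submission
  imports Defs "HOL-Probability.Characteristic_Functions" "HOL-Real_Asymp.Real_Asymp"
begin

text \<open>
  The proof is Laplace's method on a contour that passes through both saddle points. The classical
  representation \<open>H\<^sub>n(x) = (2\<^sup>n / \<surd>\<pi>) \<integral> (x + is)\<^sup>n exp (-s\<^sup>2) ds\<close> may be shifted to the line of imaginary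
  part \<open>x/2\<close>. For \<open>x = \<surd>(2n) sin \<theta>\<close> this line contains both saddle points, and the modulus of the
  integrand attains its maximum there, so that no further deformation is needed. The shifted formula
  (\<open>hermite_integral_representation\<close>) is obtained without contour integration: the integrals satisfy
  the recurrence \<open>H\<^sub>n\<^sub>+\<^sub>1 = 2x H\<^sub>n - 2n H\<^sub>n\<^sub>-\<^sub>1\<close> by integration by parts.

  The two halves of the line are complex conjugate (\<open>integral_hermite_kernel_half_line\<close>), which accounts
  for the cosine. On the right half, put \<open>a = exp (-i\<theta>)\<close> and measure the distance from the saddle point
  by \<open>u/2\<close>. Divided by its value at the saddle point, the integrand becomes the \<open>n\<close>-th power of
  \<open>(1 + ah) exp (-ah - h\<^sup>2/2)\<close> at \<open>h = u / \<surd>(2n)\<close> (\<open>hermite_kernel_at_saddle\<close>). These powers tend to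
  \<open>exp (-(cos \<theta>) a u\<^sup>2 / 2)\<close> (\<open>saddle_factor_power_tendsto\<close>), and on the whole half line they are dominated
  by a fixed Gaussian (\<open>norm_saddle_factor_le\<close>). Hence their integral tends to
  \<open>\<surd>(2\<pi>) (cos \<theta> exp (-i\<theta>))\<^bsup>-1/2\<^esup> = \<surd>(2\<pi> / cos \<theta>) exp (i\<theta>/2)\<close>, where the complex Gaussian integral is
  \<open>complex_gaussian_integral\<close>. The value at the saddle point supplies the exponential amplitude and the
  phase, and this limit supplies \<open>\<surd>(2 / cos \<theta>)\<close> and the shift \<open>\<theta>/2\<close>.
\<close>

section \<open>The Hermite recurrence\<close>

text \<open>
  Differentiating the recurrence for \<open>n - 1\<close> gives the recurrence for \<open>n\<close>. The differentiability that
  this needs is carried through the same induction, because the value of \<^term>\<open>deriv\<close> says nothing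
  at a point where there is no derivative.
\<close>
lemma iterated_deriv_gaussian_rec:
  fixes x :: real
  defines "D \<equiv> \<lambda>n. (deriv ^^ n) (\<lambda>t::real. exp (- (t ^ 2)))"
  shows "D (Suc n) x = - 2 * x * D n x - 2 * real n * D (n - 1) x"
proof -
  have "\<forall>x. (D n has_real_derivative D (Suc n) x) (at x) \<and>
          D (Suc n) x = - 2 * x * D n x - 2 * real n * D (n - 1) x" for n
  proof (induction n rule: less_induct)
    case (less n)
    show ?case
    proof (cases n)
      case 0
      have *: "((\<lambda>t::real. exp (- (t ^ 2))) has_real_derivative - 2 * x * exp (- (x ^ 2))) (at x)" for x
        by (auto intro!: derivative_eq_intros)
      from DERIV_imp_deriv[OF this] * 0 show ?thesis by (simp add: D_def)
    next
      case (Suc m)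
      have IH: "(D m has_real_derivative D n x) (at x)"
               "D n x = - 2 * x * D m x - 2 * real m * D (m - 1) x" for x
        using less[of m] Suc by blast+
      have prev: "((\<lambda>x. real m * D (m - 1) x) has_real_derivative real m * D m x) (at x)" for x
      proof (cases m)
        case (Suc l)
        have "l < n" using Suc \<open>n = Suc m\<close> by simp
        hence "(D l has_real_derivative D (Suc l) x) (at x)" using less by blast
        hence "((\<lambda>x. real m * D l x) has_real_derivative real m * D m x) (at x)"
          unfolding Suc by (rule DERIV_cmult)
        thus ?thesis using Suc by simp
      qed auto
      have "((\<lambda>x. - 2 * (x * D m x) - 2 * (real m * D (m - 1) x)) has_real_derivative
              - 2 * x * D n x - 2 * real n * D m x) (at x)" for x
        by (rule DERIV_cong[OF DERIV_diff[OF DERIV_cmult[OF DERIV_mult[OF DERIV_ident IH(1)]]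
              DERIV_cmult[OF prev]]]) (simp add: Suc algebra_simps)
      moreover have "D n = (\<lambda>x. - 2 * (x * D m x) - 2 * (real m * D (m - 1) x))"
        using IH(2) by (auto simp: mult.assoc)
      ultimately have *: "(D n has_real_derivative - 2 * x * D n x - 2 * real n * D m x) (at x)" for x
        by simp
      have "D (Suc n) x = - 2 * x * D n x - 2 * real n * D m x" for x
        using DERIV_imp_deriv[OF *] by (simp add: D_def)
      with * show ?thesis using Suc by simp
    qed
  qed
  thus ?thesis by blast
qed

lemma hermite_rec:
  "hermite 0 x = 1"
  "hermite (Suc n) x = 2 * x * hermite n x - 2 * real n * hermite (n - 1) x"
proof -
  show "hermite 0 x = 1" by (simp add: hermite_def exp_minus)
  show "hermite (Suc n) x = 2 * x * hermite n x - 2 * real n * hermite (n - 1) x"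
    unfolding hermite_def iterated_deriv_gaussian_rec
    by (cases n) (auto simp: algebra_simps)
qed

section \<open>An integral along the line through both saddle points\<close>

text \<open>
  The value at \<open>t\<close> is the integrand of \<open>H\<^sub>n(x) = (2\<^sup>n / \<surd>\<pi>) \<integral> (x + is)\<^sup>n exp (-s\<^sup>2) ds\<close> on the
  shifted line \<open>s = -t + ix/2\<close>, without the factors that do not depend on \<open>t\<close>. For \<open>x = \<surd>(2n) sin \<theta>\<close> this
  is the line that contains both saddle points, at \<open>t = \<plusminus>\<surd>(n/2) cos \<theta>\<close>, and on it they are the
  maxima of the modulus.
\<close>
definition hermite_kernel :: "real \<Rightarrow> nat \<Rightarrow> real \<Rightarrow> complex" where
  "hermite_kernel x n t = (Complex (x / 2) (- t)) ^ n * exp (Complex (- (t ^ 2)) (x * t))"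

lemma power_le_fact_exp:
  fixes y :: real
  assumes "y \<ge> 0"
  shows "y ^ n \<le> fact n * exp y"
proof -
  have "(\<lambda>k. y ^ k /\<^sub>R fact k) sums exp y" by (rule exp_converges)
  moreover from this have "sum (\<lambda>k. y ^ k /\<^sub>R fact k) {n} \<le> (\<Sum>k. y ^ k /\<^sub>R fact k)"
    using assms by (intro sum_le_suminf) (auto simp: sums_iff)
  ultimately have "y ^ n /\<^sub>R fact n \<le> exp y" by (simp add: sums_iff)
  thus ?thesis by (simp add: field_simps)
qed

text \<open>
  A Gaussian majorant gives integrability of the kernel and its decay at both ends of the line, which
  removes the boundary terms in the integration by parts.
\<close>
lemma norm_hermite_kernel_le: "norm (hermite_kernel x n t) \<le> fact n * exp ((\<bar>x\<bar> + 1) / 2) * exp (- (t ^ 2) / 2)"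
proof -
  have "norm (Complex (x / 2) (- t)) \<le> \<bar>x\<bar> / 2 + \<bar>t\<bar>"
    using cmod_le[of "Complex (x / 2) (- t)"] by simp
  hence "norm (Complex (x / 2) (- t)) ^ n \<le> (\<bar>x\<bar> / 2 + \<bar>t\<bar>) ^ n"
    by (intro power_mono) auto
  also have "\<dots> \<le> fact n * exp (\<bar>x\<bar> / 2 + \<bar>t\<bar>)" by (intro power_le_fact_exp) auto
  finally have "norm (hermite_kernel x n t) \<le> fact n * exp (\<bar>x\<bar> / 2 + \<bar>t\<bar>) * exp (- (t ^ 2))"
    by (simp add: hermite_kernel_def norm_mult norm_power)
  also have "\<dots> = fact n * exp (\<bar>x\<bar> / 2 + \<bar>t\<bar> - t ^ 2)"
    by (simp add: mult_exp_exp)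
  also have "\<dots> \<le> fact n * exp ((\<bar>x\<bar> + 1) / 2 - t ^ 2 / 2)"
  proof -
    have "0 \<le> (\<bar>t\<bar> - 1) ^ 2" by simp
    hence "\<bar>t\<bar> \<le> 1 / 2 + t ^ 2 / 2" by (simp add: power2_eq_square algebra_simps)
    thus ?thesis by (simp add: field_simps)
  qed
  also have "\<dots> = fact n * exp ((\<bar>x\<bar> + 1) / 2) * exp (- (t ^ 2) / 2)"
    by (simp add: exp_add[symmetric])
  finally show ?thesis .
qed

lemma integrable_gaussian:
  fixes k :: real assumes "k > 0"
  shows "integrable lborel (\<lambda>u::real. exp (- (k * u ^ 2)))"
proof -
  have "integrable lborel (\<lambda>u. sqrt (2 * pi * (1 / sqrt (2 * k)) ^ 2) * normal_density 0 (1 / sqrt (2 * k)) u)"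
    using assms by (intro integrable_mult_right integrable_normal_density) auto
  thus ?thesis using assms by (simp add: normal_density_def power_divide field_simps)
qed

lemma continuous_hermite_kernel: "isCont (hermite_kernel x n) t"
  unfolding hermite_kernel_def[abs_def] Complex_eq by (intro continuous_intros)

lemma borel_measurable_hermite_kernel [measurable]: "hermite_kernel x n \<in> borel_measurable borel"
  using continuous_hermite_kernel by (intro borel_measurable_continuous_onI continuous_at_imp_continuous_on) auto

lemma integrable_hermite_kernel: "integrable lborel (hermite_kernel x n)"
proof (rule Bochner_Integration.integrable_bound)
  show "integrable lborel (\<lambda>t. fact n * exp ((\<bar>x\<bar> + 1) / 2) * exp (- (1 / 2 * t ^ 2)))"
    by (intro integrable_mult_right integrable_gaussian) auto
  show "AE t in lborel. norm (hermite_kernel x n t) \<le> norm (fact n * exp ((\<bar>x\<bar> + 1) / 2) * exp (- (1 / 2 * t ^ 2)))"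
    using norm_hermite_kernel_le[of x n] by (intro AE_I2) (simp add: abs_mult)
qed auto

lemma hermite_kernel_tendsto:
  "(hermite_kernel x n \<longlongrightarrow> 0) at_top" "(hermite_kernel x n \<longlongrightarrow> 0) at_bot"
proof -
  have "((\<lambda>t. fact n * exp ((\<bar>x\<bar> + 1) / 2) * exp (- (t ^ 2) / 2)) \<longlongrightarrow> 0) at_top"
    by real_asymp
  thus "(hermite_kernel x n \<longlongrightarrow> 0) at_top"
    by (rule Lim_null_comparison[rotated]) (intro always_eventually allI norm_hermite_kernel_le)
  have "((\<lambda>t. fact n * exp ((\<bar>x\<bar> + 1) / 2) * exp (- (t ^ 2) / 2)) \<longlongrightarrow> 0) at_bot"
    by real_asymp
  thus "(hermite_kernel x n \<longlongrightarrow> 0) at_bot"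
    by (rule Lim_null_comparison[rotated]) (intro always_eventually allI norm_hermite_kernel_le)
qed

lemma hermite_kernel_deriv:
  "(hermite_kernel x n has_vector_derivative
     \<i> * (2 * of_real x * hermite_kernel x n t - 2 * hermite_kernel x (Suc n) t - of_nat n * hermite_kernel x (n - 1) t)) (at t)"
proof -
  have "((\<lambda>t. (of_real (x / 2) - \<i> * t) ^ n * exp (- (t ^ 2) + \<i> * of_real x * t)) has_field_derivative
     \<i> * (2 * of_real x * hermite_kernel x n t - 2 * hermite_kernel x (Suc n) t - of_nat n * hermite_kernel x (n - 1) t)) (at (of_real t))"
    unfolding hermite_kernel_def Complex_eq
    apply (auto intro!: derivative_eq_intros)
    apply (auto simp: algebra_simps power2_eq_square)
    done
  from has_vector_derivative_real_field[OF this]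
  show ?thesis by (simp add: hermite_kernel_def[abs_def] Complex_eq mult_ac)
qed

text \<open>
  Integrating the derivative of the kernel over the whole line gives zero. The derivative is a
  combination of kernels of neighbouring index, so this is the Hermite recurrence up to
  powers of two.
\<close>
lemma integral_hermite_kernel_rec:
  "2 * integral\<^sup>L lborel (hermite_kernel x (Suc n))
     = 2 * of_real x * integral\<^sup>L lborel (hermite_kernel x n) - of_nat n * integral\<^sup>L lborel (hermite_kernel x (n - 1))"
proof -
  define g where "g t = \<i> * (2 * of_real x * hermite_kernel x n t - 2 * hermite_kernel x (Suc n) t - of_nat n * hermite_kernel x (n - 1) t)" for t
  have int: "integrable lborel g" unfolding g_def
    by (intro integrable_mult_right Bochner_Integration.integrable_diff integrable_hermite_kernel)
  have "(LBINT t=-\<infinity>..\<infinity>. g t) = 0 - 0"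
  proof (rule interval_integral_FTC_integrable)
    show "(hermite_kernel x n has_vector_derivative g t) (at t)" for t unfolding g_def by (rule hermite_kernel_deriv)
    show "isCont g t" for t unfolding g_def by (intro continuous_intros continuous_hermite_kernel)
    show "set_integrable lborel (einterval (-\<infinity>) \<infinity>) g" using int by (simp add: set_integrable_def)
    show "((hermite_kernel x n \<circ> real_of_ereal) \<longlongrightarrow> 0) (at_right (-\<infinity>))"
      using hermite_kernel_tendsto by (simp add: at_right_MInf o_def filterlim_filtermap)
    show "((hermite_kernel x n \<circ> real_of_ereal) \<longlongrightarrow> 0) (at_left \<infinity>)"
      using hermite_kernel_tendsto by (simp add: at_left_PInf o_def filterlim_filtermap)
  qed auto
  hence "integral\<^sup>L lborel g = 0"
    by (simp add: interval_lebesgue_integral_def set_lebesgue_integral_def)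
  hence "0 = \<i> * (2 * of_real x * integral\<^sup>L lborel (hermite_kernel x n) - 2 * integral\<^sup>L lborel (hermite_kernel x (Suc n))
     - of_nat n * integral\<^sup>L lborel (hermite_kernel x (n - 1)))"
    unfolding g_def by (simp add: integrable_hermite_kernel)
  hence "2 * of_real x * integral\<^sup>L lborel (hermite_kernel x n) - 2 * integral\<^sup>L lborel (hermite_kernel x (Suc n))
     - of_nat n * integral\<^sup>L lborel (hermite_kernel x (n - 1)) = 0"
    by (metis complex_i_not_zero mult_eq_0_iff)
  thus ?thesis by (metis add_diff_cancel_left' diff_add_cancel diff_eq_eq diff_zero add.commute)
qed

lemma integral_hermite_kernel_0: "integral\<^sup>L lborel (hermite_kernel x 0) = of_real (sqrt pi * exp (- (x ^ 2) / 4))"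
proof -
  have "integral\<^sup>L lborel (hermite_kernel x 0) = (1 / sqrt 2) *\<^sub>R (\<integral>u. hermite_kernel x 0 (u / sqrt 2) \<partial>lborel)"
    using lborel_integral_real_affine[of "1 / sqrt 2" "hermite_kernel x 0" 0] by simp
  also have "(\<integral>u. hermite_kernel x 0 (u / sqrt 2) \<partial>lborel)
      = (\<integral>u. of_real (sqrt (2 * pi)) * (std_normal_density u *\<^sub>R iexp (x / sqrt 2 * u)) \<partial>lborel)"
    by (intro Bochner_Integration.integral_cong)
       (auto simp: hermite_kernel_def normal_density_def Complex_eq scaleR_conv_of_real power_divide mult_exp_exp
          exp_of_real [symmetric] mult_ac real_sqrt_mult)
  also have "\<dots> = of_real (sqrt (2 * pi)) * char std_normal_distribution (x / sqrt 2)"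
    unfolding char_def
    by (subst integral_density, simp_all del: real_sqrt_mult, subst integral_mult_right_zero[symmetric], simp)
  also have "\<dots> = of_real (sqrt (2 * pi) * exp (- (x ^ 2) / 4))"
    by (simp add: char_std_normal_distribution power_divide)
  finally show ?thesis by (simp add: real_sqrt_mult scaleR_conv_of_real field_simps)
qed

text \<open>
  Both sides satisfy the same three-term recurrence. At \<open>n = 0\<close> the integral is the characteristic
  function of the normal distribution. For \<open>n = 1\<close> the coefficient of the term of index \<open>n - 2\<close>
  vanishes, so no second initial value has to be computed.
\<close>
lemma hermite_integral_representation:
  "complex_of_real (hermite n x) =
     2 ^ n * of_real (exp (x ^ 2 / 4) / sqrt pi) * integral\<^sup>L lborel (hermite_kernel x n)"
proof (induction n rule: less_induct)
  case (less n)
  let ?C = "complex_of_real (exp (x ^ 2 / 4) / sqrt pi)" and ?I = "\<lambda>n. integral\<^sup>L lborel (hermite_kernel x n)"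
  show ?case
  proof (cases n)
    case 0
    thus ?thesis by (simp add: hermite_rec integral_hermite_kernel_0 flip: of_real_mult exp_add)
  next
    case (Suc m)
    have prev: "of_nat m * complex_of_real (hermite (m - 1) x) * 2 = of_nat m * 2 ^ m * ?C * ?I (m - 1)"
      using less[of "m - 1"] Suc by (cases m) auto
    have "complex_of_real (hermite n x) = 2 * of_real x * of_real (hermite m x)
            - of_nat m * of_real (hermite (m - 1) x) * 2"
      by (simp add: Suc hermite_rec)
    also have "\<dots> = 2 ^ m * ?C * (2 * of_real x * ?I m - of_nat m * ?I (m - 1))"
      using less[of m] Suc unfolding prev by (simp add: algebra_simps)
    also have "\<dots> = 2 ^ n * ?C * ?I n"
      unfolding integral_hermite_kernel_rec[symmetric] Suc by simp
    finally show ?thesis .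
  qed
qed

lemma hermite_kernel_cnj: "hermite_kernel x n (- t) = cnj (hermite_kernel x n t)"
proof -
  have 1: "Complex (x / 2) t = cnj (Complex (x / 2) (- t))" by (simp add: complex_eq_iff)
  have 2: "Complex (- (t ^ 2)) (- (x * t)) = cnj (Complex (- (t ^ 2)) (x * t))" by (simp add: complex_eq_iff)
  show ?thesis by (simp add: hermite_kernel_def 1 2 exp_cnj)
qed

text \<open>
  Reflection at \<open>0\<close> conjugates the kernel, so the two saddle points contribute complex conjugate
  amounts and one of them determines the oscillating real part.
\<close>
lemma integral_hermite_kernel_half_line:
  "integral\<^sup>L lborel (hermite_kernel x n) = of_real (2 * Re (\<integral>t. indicator {0..} t *\<^sub>R hermite_kernel x n t \<partial>lborel))"
proof -
  let ?f = "\<lambda>t. indicator {0..} t *\<^sub>R hermite_kernel x n t"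
  have int: "integrable lborel ?f"
    using integrable_hermite_kernel[of x n] by (rule integrable_mult_indicator[rotated]) auto
  have int': "integrable lborel (\<lambda>t. ?f (- t))"
    using lborel_integrable_real_affine[OF int, of "-1" 0] by simp
  have int_sum: "integrable lborel (\<lambda>t. ?f t + cnj (?f (- t)))"
    using int int' by (intro Bochner_Integration.integrable_add) (simp_all del: complex_cnj_scaleR)
  have "integral\<^sup>L lborel (hermite_kernel x n) = (\<integral>t. ?f t + cnj (?f (- t)) \<partial>lborel)"
  proof (rule integral_cong_AE)
    show "AE t in lborel. hermite_kernel x n t = ?f t + cnj (?f (- t))"
      using AE_lborel_singleton[of "0::real"]
      by eventually_elim (auto simp: indicator_def hermite_kernel_cnj)
    show "(\<lambda>t. ?f t + cnj (?f (- t))) \<in> borel_measurable lborel"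
      using int_sum by (rule borel_measurable_integrable)
  qed auto
  also have "\<dots> = integral\<^sup>L lborel ?f + cnj (\<integral>t. ?f (- t) \<partial>lborel)"
    using int int' by (subst Bochner_Integration.integral_add) (simp_all del: complex_cnj_scaleR)
  also have "(\<integral>t. ?f (- t) \<partial>lborel) = integral\<^sup>L lborel ?f"
    using lborel_integral_real_affine[of "-1" ?f 0] by simp
  finally show ?thesis by (simp add: complex_add_cnj)
qed

section \<open>The integrand near a saddle point\<close>

text \<open>
  With \<open>a = exp (-i\<theta>)\<close>, the \<open>n\<close>-th power of this factor at \<open>h = u / \<surd>(2n)\<close> is the quotient of the
  kernel at distance \<open>u/2\<close> from the right saddle point by its value there.
\<close>
definition saddle_factor :: "complex \<Rightarrow> real \<Rightarrow> complex" where
  "saddle_factor a h = (1 + a * of_real h) * exp (- (a * of_real h) - of_real (h ^ 2 / 2))"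

text \<open>
  For \<open>w > -1\<close>, take logarithms; both resulting inequalities follow from the sign of a derivative. One
  quadratic bound cannot serve all \<open>w\<close>, since \<open>w - ln (1 + w)\<close> grows only linearly.
\<close>
lemma one_plus_mult_exp_minus_le:
  fixes w :: real
  assumes "w \<ge> -1"
  shows "(1 + w) * exp (- w) \<le> exp (- (w ^ 2 / (2 * (1 + max w 0))))"
proof (cases "w = -1")
  case False
  define f where "f = (\<lambda>w::real. w - w ^ 2 / 2 - ln (1 + w))"
  define g where "g = (\<lambda>w::real. w - w ^ 2 / (2 * (1 + w)) - ln (1 + w))"
  have w: "w > -1" using assms False by auto
  have "ln (1 + w) \<le> w - w ^ 2 / (2 * (1 + max w 0))"
  proof (cases "w \<ge> 0")
    case True
    have "g 0 \<le> g w"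
    proof (rule DERIV_nonneg_imp_nondecreasing[OF True, of g])
      fix u :: real assume u: "0 \<le> u"
      have "(g has_real_derivative (u / (1 + u)) ^ 2 / 2) (at u)"
      proof -
        define y where "y = 1 + u"
        have y: "y > 0" "u = y - 1" using u by (auto simp: y_def)
        have "1 - (2 * u * (2 * (1 + u)) - u ^ 2 * 2) / (2 * (1 + u)) ^ 2 - 1 / (1 + u) = (u / (1 + u)) ^ 2 / 2"
          unfolding y(2) using y(1) by (simp add: field_simps power2_eq_square)
        note eq = this
        have "(g has_real_derivative
            1 - (2 * u * (2 * (1 + u)) - u ^ 2 * 2) / (2 * (1 + u)) ^ 2 - 1 / (1 + u)) (at u)"
          unfolding g_def using u by (auto intro!: derivative_eq_intros simp: power2_eq_square)
        thus ?thesis unfolding eq .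
      qed
      moreover have "(u / (1 + u)) ^ 2 / 2 \<ge> 0" by simp
      ultimately show "\<exists>y. (g has_real_derivative y) (at u) \<and> y \<ge> 0" by blast
    qed
    thus ?thesis using True by (simp add: g_def max_def)
  next
    case False
    have "f 0 \<le> f w"
    proof (rule DERIV_nonpos_imp_nonincreasing[of w 0 f])
      fix u :: real assume u: "w \<le> u" "u \<le> 0"
      have "(f has_real_derivative - (u ^ 2) / (1 + u)) (at u)"
        unfolding f_def using u w
        by (auto intro!: derivative_eq_intros simp: field_simps power2_eq_square)
      moreover have "- (u ^ 2) / (1 + u) \<le> 0" using u w by simp
      ultimately show "\<exists>y. (f has_real_derivative y) (at u) \<and> y \<le> 0" by blast
    qed (use False in auto)
    thus ?thesis using False by (simp add: f_def max_def)
  qed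
  hence "exp (ln (1 + w)) * exp (- w) \<le> exp (w - w ^ 2 / (2 * (1 + max w 0))) * exp (- w)"
    by (intro mult_right_mono) auto
  thus ?thesis using w by (simp add: mult_exp_exp)
qed auto

text \<open>
  This Gaussian bound dominates the integrands uniformly in \<open>n\<close>. With \<open>1 + w = \<bar>1 + ah\<bar>\<^sup>2\<close> the squared
  modulus is \<open>(1 + w) exp (-w)\<close>, where \<open>w = h (2c + h)\<close> and \<open>c = Re a\<close>. The factor \<open>2c + h\<close> is bounded below by
  \<open>c\<close> on the half line \<open>h \<ge> -c\<close>, which excludes its zero \<open>h = -2c\<close>, the second saddle point.
\<close>
lemma norm_saddle_factor_le:
  fixes a :: complex
  assumes a: "norm a = 1" "Re a \<ge> 0" and h: "h \<ge> - Re a"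
  shows "norm (saddle_factor a h) \<le> exp (- ((Re a * h) ^ 2 / 4))"
proof -
  define c where "c = Re a"
  define w where "w = 2 * c * h + h ^ 2"
  have sq: "norm (1 + a * of_real h) ^ 2 = 1 + w"
  proof -
    have "Re a ^ 2 + Im a ^ 2 = 1" using a(1) by (simp add: cmod_def)
    hence "c ^ 2 * h ^ 2 + Im a ^ 2 * h ^ 2 = h ^ 2" unfolding c_def by (metis distrib_right mult_1)
    thus ?thesis unfolding cmod_power2 w_def by (simp add: c_def power2_eq_square algebra_simps)
  qed
  have "w \<ge> -1" using zero_le_power2[of "norm (1 + a * of_real h)"] sq by linarith
  have c: "0 \<le> c" "c \<le> 1" using a complex_Re_le_cmod[of a] by (auto simp: c_def)
  \<comment> \<open>Both cases compare \<open>w\<^sup>2 = h\<^sup>2 (2c + h)\<^sup>2\<close> with a multiple of \<open>h\<^sup>2\<close>. For \<open>w \<ge> 0\<close> the extra factor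
    \<open>1 + w = 1 - c\<^sup>2 + (c + h)\<^sup>2\<close> is absorbed by \<open>(2c + h)\<^sup>2 \<ge> c\<^sup>2 + (c + h)\<^sup>2\<close>.\<close>
  have key: "(c * h) ^ 2 / 2 \<le> w ^ 2 / (2 * (1 + max w 0))"
  proof (cases "w \<ge> 0")
    case True
    have "c ^ 2 * (1 + w) \<le> (2 * c + h) ^ 2"
    proof -
      have "c ^ 2 * (1 + w) = c ^ 2 * (1 - c ^ 2 + (c + h) ^ 2)"
        by (simp add: w_def power2_eq_square algebra_simps)
      also have "\<dots> \<le> c ^ 2 + 1 * (c + h) ^ 2"
      proof -
        have "c ^ 2 * (1 - c ^ 2) \<le> c ^ 2 * 1" by (intro mult_left_mono) auto
        moreover have "c ^ 2 * (c + h) ^ 2 \<le> 1 * (c + h) ^ 2"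
          using c by (intro mult_right_mono) (auto simp: power_le_one)
        ultimately show ?thesis unfolding distrib_left by simp
      qed
      also have "\<dots> \<le> (2 * c + h) ^ 2"
      proof -
        have "0 \<le> c * (c + h)" using c h by (intro mult_nonneg_nonneg) (auto simp: c_def)
        thus ?thesis by (simp add: power2_eq_square algebra_simps)
      qed
      finally show ?thesis .
    qed
    hence "h ^ 2 * (c ^ 2 * (1 + w)) \<le> h ^ 2 * (2 * c + h) ^ 2" by (intro mult_left_mono) auto
    also have "\<dots> = w ^ 2" by (simp add: w_def power2_eq_square algebra_simps)
    finally show ?thesis using True by (simp add: max_def field_simps power_mult_distrib)
  next
    case False
    have "c ^ 2 \<le> (2 * c + h) ^ 2" using c h by (intro power_mono) (auto simp: c_def)
    hence "h ^ 2 * c ^ 2 \<le> h ^ 2 * (2 * c + h) ^ 2" by (intro mult_left_mono) auto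
    also have "\<dots> = w ^ 2" by (simp add: w_def power2_eq_square algebra_simps)
    finally show ?thesis using False by (simp add: max_def power_mult_distrib mult.commute)
  qed
  have "norm (saddle_factor a h) ^ 2 = (1 + w) * exp (- c * h - h ^ 2 / 2) ^ 2"
    by (simp add: saddle_factor_def norm_mult power_mult_distrib sq c_def)
  also have "exp (- c * h - h ^ 2 / 2) ^ 2 = exp (- w)"
    by (simp add: exp_double[symmetric] w_def algebra_simps)
  also have "(1 + w) * exp (- w) \<le> exp (- (w ^ 2 / (2 * (1 + max w 0))))"
    by (rule one_plus_mult_exp_minus_le) fact
  also have "\<dots> \<le> exp (- ((c * h) ^ 2 / 2))" using key by simp
  also have "\<dots> = exp (- ((c * h) ^ 2 / 4)) ^ 2" by (simp add: exp_double[symmetric])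
  finally show ?thesis by (simp add: c_def power2_le_iff_abs_le)
qed

text \<open>
  The exponent cancels the terms of order one and two of \<open>ln (1 + z)\<close>: the derivative of the product is
  \<open>z\<^sup>2 exp (-z + z\<^sup>2/2)\<close>, and integrating a quadratic bound yields a cubic one.
\<close>
lemma one_plus_mult_exp_cubic_remainder:
  fixes z :: complex
  assumes "norm z \<le> 1"
  shows "norm ((1 + z) * exp (- z + z ^ 2 / 2) - 1) \<le> exp 2 * norm z ^ 3"
proof -
  let ?F = "\<lambda>z::complex. (1 + z) * exp (- z + z ^ 2 / 2)"
  have "norm (?F z - ?F 0) \<le> exp 2 * norm z ^ 2 * norm (z - 0)"
  proof (rule field_differentiable_bound[where S = "cball 0 (norm z)"])
    fix y :: complex assume "y \<in> cball 0 (norm z)"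
    hence y: "norm y \<le> norm z" by simp
    show "(?F has_field_derivative exp (- y + y ^ 2 / 2) * y ^ 2) (at y within cball 0 (norm z))"
      by (auto intro!: derivative_eq_intros simp: algebra_simps power2_eq_square)
    have "norm (exp (- y + y ^ 2 / 2)) \<le> exp (norm (- y + y ^ 2 / 2))" by (rule norm_exp)
    also have "norm (- y + y ^ 2 / 2) \<le> norm y + norm y ^ 2 / 2"
      by (rule order.trans[OF norm_triangle_ineq]) (simp add: norm_power norm_divide)
    also have "\<dots> \<le> 2" using y assms power_le_one[of "norm y" 2] by simp
    finally show "norm (exp (- y + y ^ 2 / 2) * y ^ 2) \<le> exp 2 * norm z ^ 2"
      unfolding norm_mult norm_power using y by (intro mult_mono power_mono) auto
  qed auto
  thus ?thesis by (simp add: power3_eq_cube power2_eq_square)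
qed

text \<open>
  The factor differs from the Gaussian \<open>exp (-(1 + a\<^sup>2) h\<^sup>2 / 2)\<close> by \<open>O(h\<^sup>3)\<close>. For
  \<open>h = u / \<surd>(2n)\<close> both are at most \<open>1\<close> in modulus once \<open>n\<close> is large, so their \<open>n\<close>-th powers differ by at most
  \<open>n\<close> times that error, which is \<open>O(1 / \<surd>n)\<close>.
\<close>
lemma saddle_factor_power_tendsto:
  fixes a :: complex
  assumes a: "norm a = 1" "Re a > 0"
  shows "(\<lambda>n. saddle_factor a (u / sqrt (2 * real n)) ^ n)
           \<longlonglongrightarrow> exp (- ((1 + a ^ 2) / 4 * of_real (u ^ 2)))"
proof -
  define h where "h n = u / sqrt (2 * real n)" for n
  define w where "w n = exp (- ((1 + a ^ 2) / 2 * of_real (h n ^ 2)))" for n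
  have Re_pos: "Re (1 + a ^ 2) \<ge> 0"
    using a abs_Re_le_cmod[of "a ^ 2"] by (simp add: norm_power)
  have norm_w: "norm (w n) \<le> 1" for n
    unfolding w_def norm_exp_eq_Re using Re_pos by (simp add: zero_le_mult_iff)
  have "h \<longlonglongrightarrow> 0" unfolding h_def by real_asymp
  have ev: "eventually (\<lambda>n. \<bar>h n\<bar> < Re a) sequentially"
    using order_tendstoD(2)[OF tendsto_rabs[OF \<open>h \<longlonglongrightarrow> 0\<close>], of "Re a"] a by simp
  have "(\<lambda>n. saddle_factor a (h n) ^ n - w n ^ n) \<longlonglongrightarrow> 0"
  proof (rule Lim_null_comparison)
    show "(\<lambda>n. real n * (exp 2 * \<bar>h n\<bar> ^ 3)) \<longlonglongrightarrow> 0"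
    proof -
      have "(\<lambda>n. real n / sqrt (2 * real n) ^ 3) \<longlonglongrightarrow> 0"
        by real_asymp
      from tendsto_mult_right_zero[OF this, of "exp 2 * \<bar>u\<bar> ^ 3"] show ?thesis
        by (simp add: h_def power_divide mult_ac)
    qed
    show "eventually (\<lambda>n. norm (saddle_factor a (h n) ^ n - w n ^ n) \<le> real n * (exp 2 * \<bar>h n\<bar> ^ 3)) sequentially"
      using ev
    proof eventually_elim
      case (elim n)
      let ?z = "a * of_real (h n)"
      have "norm ?z \<le> 1" using elim a complex_Re_le_cmod[of a] by (simp add: norm_mult)
      have "saddle_factor a (h n) = (1 + ?z) * exp (- ?z + ?z ^ 2 / 2) * w n"
      proof -
        have "- ?z - of_real (h n ^ 2 / 2) = (- ?z + ?z ^ 2 / 2) + (- ((1 + a ^ 2) / 2 * of_real (h n ^ 2)))"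
          by (simp add: field_simps power_mult_distrib)
        thus ?thesis unfolding saddle_factor_def w_def mult.assoc mult_exp_exp by (rule arg_cong)
      qed
      hence "saddle_factor a (h n) - w n = ((1 + ?z) * exp (- ?z + ?z ^ 2 / 2) - 1) * w n"
        by (simp add: algebra_simps)
      hence "norm (saddle_factor a (h n) - w n) = norm ((1 + ?z) * exp (- ?z + ?z ^ 2 / 2) - 1) * norm (w n)"
        by (simp only: norm_mult)
      also have "\<dots> \<le> (exp 2 * norm ?z ^ 3) * 1"
        using \<open>norm ?z \<le> 1\<close> by (intro mult_mono one_plus_mult_exp_cubic_remainder norm_w) auto
      also have "\<dots> = exp 2 * \<bar>h n\<bar> ^ 3" using a by (simp add: norm_mult)
      finally have "real n * norm (saddle_factor a (h n) - w n) \<le> real n * (exp 2 * \<bar>h n\<bar> ^ 3)"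
        by (intro mult_left_mono) auto
      moreover have "norm (saddle_factor a (h n)) \<le> 1"
        using a elim by (intro order.trans[OF norm_saddle_factor_le]) auto
      ultimately show ?case
        using norm_power_diff[of "saddle_factor a (h n)" "w n" n] norm_w[of n] by linarith
    qed
  qed
  moreover have "eventually (\<lambda>n. w n ^ n = exp (- ((1 + a ^ 2) / 4 * of_real (u ^ 2)))) sequentially"
    using eventually_gt_at_top[of 0]
  proof eventually_elim
    case (elim n)
    have "h n ^ 2 = u ^ 2 / (2 * real n)" using elim by (simp add: h_def power_divide)
    hence "of_nat n * (- ((1 + a ^ 2) / 2 * of_real (h n ^ 2))) = - ((1 + a ^ 2) / 4 * of_real (u ^ 2))"
      using elim by simp
    thus ?case unfolding w_def exp_of_nat_mult[symmetric] by (rule arg_cong)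
  qed
  ultimately have "(\<lambda>n. (saddle_factor a (h n) ^ n - w n ^ n) + w n ^ n)
     \<longlonglongrightarrow> 0 + exp (- ((1 + a ^ 2) / 4 * of_real (u ^ 2)))"
    by (rule tendsto_add[OF _ tendsto_eventually])
  thus ?thesis by (simp add: h_def)
qed

section \<open>Laplace's method\<close>

text \<open>
  Expanding the exponential in powers of \<open>z\<close> and integrating term by term turns the even moments of
  the normal distribution into the binomial series of exponent \<open>-1/2\<close>. Working with this series
  selects the principal branch of the square root at once.
\<close>
lemma complex_gaussian_integral:
  fixes z :: complex
  assumes z: "norm z < 1"
  shows "(\<integral>u. of_real (std_normal_density u) * exp (- z * of_real (u ^ 2) / 2) \<partial>lborel)
           = (1 + z) powr (- 1 / 2)"
proof -
  define f where "f k u = of_real (std_normal_density u * u ^ (2 * k)) * ((- z / 2) ^ k / fact k)"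
    for k :: nat and u :: real
  define m :: "nat \<Rightarrow> real" where "m k = fact (2 * k) / (2 ^ k * fact k)" for k
  have int_f: "has_bochner_integral lborel (f k) (of_real (m k) * ((- z / 2) ^ k / fact k))" for k
    unfolding f_def m_def
    by (intro has_bochner_integral_mult_left has_bochner_integral_of_real std_normal_moment_even)
  have exp_sums: "(\<lambda>k. f k u) sums (of_real (std_normal_density u) * exp (- z * of_real (u ^ 2) / 2))" for u
  proof -
    have "(\<lambda>k. of_real (std_normal_density u) * ((- z * of_real (u ^ 2) / 2) ^ k /\<^sub>R fact k)) sums
       (of_real (std_normal_density u) * exp (- z * of_real (u ^ 2) / 2))"
      by (intro sums_mult exp_converges)
    also have "(\<lambda>k. of_real (std_normal_density u) * ((- z * of_real (u ^ 2) / 2) ^ k /\<^sub>R fact k)) = (\<lambda>k. f k u)"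
    proof
      fix k
      have "- z * of_real (u ^ 2) / 2 = (- z / 2) * of_real u ^ 2" by simp
      hence "(- z * of_real (u ^ 2) / 2) ^ k = (- z / 2) ^ k * of_real u ^ (2 * k)"
        by (simp only: power_mult_distrib power_mult)
      thus "of_real (std_normal_density u) * ((- z * of_real (u ^ 2) / 2) ^ k /\<^sub>R fact k) = f k u"
        by (simp add: f_def scaleR_conv_of_real field_simps)
    qed
    finally show ?thesis .
  qed
  have coeff: "of_real (m k) * ((- z / 2) ^ k / fact k) = ((- 1 / 2) gchoose k) * z ^ k" for k
  proof -
    have "complex_of_real (m k) = 2 ^ k * pochhammer (1 / 2) k"
    proof -
      have "(2 :: complex) ^ (2 * k) = 2 ^ k * 2 ^ k" by (simp add: mult_2 power_add)
      thus ?thesis by (simp add: m_def fact_double flip: pochhammer_of_real)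
    qed
    moreover have "(- z / 2) ^ k = (- 1) ^ k * z ^ k / 2 ^ k"
      by (simp only: power_divide power_minus[of z])
    ultimately show ?thesis
      by (simp add: gbinomial_pochhammer)
  qed
  have norm_f: "norm (f k u) = std_normal_density u * u ^ (2 * k) * ((norm z / 2) ^ k / fact k)" for k u
    by (simp add: f_def norm_mult norm_power norm_divide power_mult abs_mult)
  have "has_bochner_integral lborel (\<lambda>u. norm (f k u)) (m k * ((norm z / 2) ^ k / fact k))" for k
    unfolding norm_f m_def by (intro has_bochner_integral_mult_left std_normal_moment_even)
  hence int_norm: "(\<integral>u. norm (f k u) \<partial>lborel) = m k * ((norm z / 2) ^ k / fact k)" for k
    by (simp add: has_bochner_integral_iff)
  have int_norm': "norm (m k * ((norm z / 2) ^ k / fact k)) = norm (((- 1 / 2) gchoose k) * z ^ k)" for k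
    by (subst coeff[symmetric]) (simp add: norm_mult norm_power norm_divide m_def abs_mult)
  have le: "norm ((- 1 / 2 :: complex) gchoose k) \<le> 1" for k
  proof -
    have "((- 1 / 2 :: complex) gchoose k) = of_real ((-1) ^ k * pochhammer (1 / 2) k / fact k)"
      by (simp add: gbinomial_pochhammer flip: pochhammer_of_real)
    hence "norm ((- 1 / 2 :: complex) gchoose k) = pochhammer (1 / 2) k / fact k"
      by (simp only: norm_of_real) (simp add: abs_mult pochhammer_nonneg)
    also have "pochhammer (1 / 2) k \<le> (fact k :: real)"
      unfolding pochhammer_fact pochhammer_prod by (intro prod_mono) auto
    hence "pochhammer (1 / 2) k / fact k \<le> (1 :: real)" by simp
    finally show ?thesis .
  qed
  have "summable (\<lambda>k. \<integral>u. norm (f k u) \<partial>lborel)"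
  proof (rule summable_comparison_test')
    show "summable (\<lambda>k. norm z ^ k)" using z by (intro summable_geometric) auto
    show "norm (\<integral>u. norm (f k u) \<partial>lborel) \<le> norm z ^ k" for k
      unfolding int_norm int_norm' using mult_right_mono[OF le, of "norm z ^ k" k]
      by (simp add: norm_mult norm_power)
  qed
  moreover have "summable (\<lambda>k. norm (f k u))" for u
  proof -
    have "std_normal_density u * ((norm z * u ^ 2 / 2) ^ k /\<^sub>R fact k) = norm (f k u)" for k
    proof -
      have *: "(norm z * u ^ 2 / 2) ^ k = (norm z / 2) ^ k * u ^ (2 * k)"
        unfolding power_mult power_mult_distrib[symmetric] by simp
      show ?thesis unfolding norm_f * real_scaleR_def by (simp only: divide_inverse mult_ac)
    qed
    moreover have "summable (\<lambda>k. std_normal_density u * ((norm z * u ^ 2 / 2) ^ k /\<^sub>R fact k))"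
      by (intro summable_mult summable_exp_generic)
    ultimately show ?thesis by simp
  qed
  ultimately have "(\<lambda>k. integral\<^sup>L lborel (f k)) sums (\<integral>u. (\<Sum>k. f k u) \<partial>lborel)"
    using int_f by (intro sums_integral) (auto simp: has_bochner_integral_iff)
  moreover have "(\<Sum>k. f k u) = of_real (std_normal_density u) * exp (- z * of_real (u ^ 2) / 2)" for u
    using exp_sums sums_unique by metis
  moreover have "integral\<^sup>L lborel (f k) = ((- 1 / 2) gchoose k) * z ^ k" for k
    using int_f coeff by (simp add: has_bochner_integral_iff)
  ultimately have "(\<lambda>k. ((- 1 / 2) gchoose k) * z ^ k) sums
      (\<integral>u. of_real (std_normal_density u) * exp (- z * of_real (u ^ 2) / 2) \<partial>lborel)"
    by simp
  thus ?thesis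
    using gen_binomial_complex[OF z, of "- 1 / 2"] sums_unique2 by blast
qed

lemma continuous_saddle_factor: "isCont (saddle_factor a) h"
  unfolding saddle_factor_def[abs_def] by (intro continuous_intros) auto

text \<open>
  Dominated convergence reduces the claim to a Gaussian integral with the complex coefficient \<open>c a\<close>:
  since \<open>\<bar>a\<bar> = 1\<close>, \<open>1 + a\<^sup>2 = a (cnj a + a) = 2 c a\<close>.
\<close>
lemma laplace_saddle_integral:
  fixes a :: complex
  assumes a: "norm a = 1" "Re a > 0"
  defines "c \<equiv> Re a"
  shows "(\<lambda>n. \<integral>u. indicator {- (c * sqrt (2 * real n))..} u *\<^sub>R
             saddle_factor a (u / sqrt (2 * real n)) ^ n \<partial>lborel)
         \<longlonglongrightarrow> of_real (sqrt (2 * pi)) * (of_real c * a) powr (- 1 / 2)"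
proof -
  define s where "s n u = indicator {- (c * sqrt (2 * real n))..} u *\<^sub>R
             saddle_factor a (u / sqrt (2 * real n)) ^ n" for n u
  define f where "f u = exp (- ((1 + a ^ 2) / 4 * of_real (u ^ 2)))" for u
  have c: "c > 0" using a by (simp add: c_def)
  have sq: "1 + a ^ 2 = 2 * of_real c * a"
  proof -
    have "a * cnj a = 1" using a(1) complex_norm_square[of a] by simp
    hence "1 + a ^ 2 = a * (cnj a + a)" by (simp add: algebra_simps power2_eq_square)
    also have "cnj a + a = of_real (2 * c)" by (simp add: c_def complex_add_cnj add.commute)
    finally show ?thesis by simp
  qed
  \<comment> \<open>At \<open>n = 0\<close> the integrand is the indicator of a half line, which is not integrable, so the
    dominated sequence starts at \<open>1\<close>.\<close>
  have "(\<lambda>n. integral\<^sup>L lborel (s (Suc n))) \<longlonglongrightarrow> integral\<^sup>L lborel f"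
  proof (rule integral_dominated_convergence)
    have "f \<in> borel_measurable borel" unfolding f_def
      by (intro borel_measurable_continuous_onI continuous_intros) simp
    thus "f \<in> borel_measurable lborel" by simp
    show "s (Suc n) \<in> borel_measurable lborel" for n
    proof -
      have "isCont (\<lambda>u. saddle_factor a (u / sqrt (2 * real (Suc n))) ^ Suc n) u" for u
        by (intro continuous_intros isCont_o2[OF _ continuous_saddle_factor]) auto
      hence "(\<lambda>u. saddle_factor a (u / sqrt (2 * real (Suc n))) ^ Suc n) \<in> borel_measurable borel"
        by (intro borel_measurable_continuous_onI continuous_at_imp_continuous_on) auto
      thus ?thesis unfolding s_def by measurable
    qed
    show "integrable lborel (\<lambda>u. exp (- (c ^ 2 / 8 * u ^ 2)))"
      using c by (intro integrable_gaussian) auto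
    show "AE u in lborel. norm (s (Suc n) u) \<le> exp (- (c ^ 2 / 8 * u ^ 2))" for n
    proof (rule AE_I2)
      fix u :: real
      show "norm (s (Suc n) u) \<le> exp (- (c ^ 2 / 8 * u ^ 2))"
      proof (cases "u \<ge> - (c * sqrt (2 * real (Suc n)))")
        case True
        define h where "h = u / sqrt (2 * real (Suc n))"
        have "h \<ge> - Re a" using True by (simp add: h_def c_def field_simps)
        hence "norm (saddle_factor a h) \<le> exp (- ((c * h) ^ 2 / 4))"
          using norm_saddle_factor_le[of a h] a by (simp add: c_def)
        hence "norm (saddle_factor a h) ^ Suc n \<le> exp (- ((c * h) ^ 2 / 4)) ^ Suc n"
          by (intro power_mono) auto
        also have "\<dots> = exp (real (Suc n) * (- ((c * h) ^ 2 / 4)))"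
          by (rule exp_of_nat_mult[symmetric])
        also have "real (Suc n) * (- ((c * h) ^ 2 / 4)) = - (c ^ 2 / 8 * u ^ 2)"
          by (simp add: h_def power_mult_distrib power_divide field_simps del: of_nat_Suc)
        finally show ?thesis using True by (simp add: s_def h_def norm_mult norm_power del: power_Suc)
      qed (simp add: s_def)
    qed
    show "AE u in lborel. (\<lambda>n. s (Suc n) u) \<longlonglongrightarrow> f u"
    proof (rule AE_I2)
      fix u :: real
      have "eventually (\<lambda>n. - (c * sqrt (2 * real n)) \<le> u) sequentially"
        using c by real_asymp
      hence "eventually (\<lambda>n. saddle_factor a (u / sqrt (2 * real n)) ^ n = s n u) sequentially"
        by eventually_elim (simp add: s_def)
      from Lim_transform_eventually[OF saddle_factor_power_tendsto[OF a] this]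
      have "(\<lambda>n. s n u) \<longlonglongrightarrow> f u" by (simp add: f_def)
      thus "(\<lambda>n. s (Suc n) u) \<longlonglongrightarrow> f u" by (rule LIMSEQ_Suc)
    qed
  qed
  hence lim: "(\<lambda>n. integral\<^sup>L lborel (s n)) \<longlonglongrightarrow> integral\<^sup>L lborel f"
    by (rule LIMSEQ_imp_Suc)
  define z where "z = of_real c * a - 1"
  have "norm z < 1"
  proof -
    have "(norm z)\<^sup>2 = c ^ 2 * (norm a) ^ 2 - 2 * c ^ 2 + 1"
      unfolding cmod_power2 by (simp add: z_def c_def power2_eq_square algebra_simps)
    also have "\<dots> < 1 ^ 2" using a c by simp
    finally show ?thesis by (rule power_less_imp_less_base) auto
  qed
  have "f u = of_real (sqrt (2 * pi)) * (of_real (std_normal_density u) * exp (- z * of_real (u ^ 2) / 2))" for u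
  proof -
    have "f u = exp (of_real (- (u ^ 2) / 2) + (- z * of_real (u ^ 2) / 2))"
      unfolding f_def sq by (simp add: z_def field_simps)
    also have "\<dots> = of_real (exp (- (u ^ 2) / 2)) * exp (- z * of_real (u ^ 2) / 2)"
      by (simp only: exp_add exp_of_real)
    also have "exp (- (u ^ 2) / 2) = sqrt (2 * pi) * std_normal_density u"
      by (simp add: normal_density_def)
    finally show ?thesis by (simp add: mult.assoc del: real_sqrt_mult)
  qed
  hence "integral\<^sup>L lborel f = (\<integral>u. of_real (sqrt (2 * pi)) *
       (of_real (std_normal_density u) * exp (- z * of_real (u ^ 2) / 2)) \<partial>lborel)"
    by (rule Bochner_Integration.integral_cong[OF refl])
  also have "\<dots> = of_real (sqrt (2 * pi)) *
       (\<integral>u. of_real (std_normal_density u) * exp (- z * of_real (u ^ 2) / 2) \<partial>lborel)"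
    by (rule integral_mult_right_zero)
  also have "\<dots> = of_real (sqrt (2 * pi)) * (1 + z) powr (- 1 / 2)"
    by (simp only: complex_gaussian_integral[OF \<open>norm z < 1\<close>])
  finally show ?thesis using lim by (simp add: z_def s_def[abs_def])
qed

section \<open>Evaluation at the saddle point\<close>

text \<open>
  The saddle point is \<open>\<surd>(n/2) cos \<theta>\<close>. The linear terms of the exponent combine to \<open>-a\<close>, which is the
  saddle point condition. The displacement is written \<open>u/2\<close> so that the quadratic
  exponent becomes \<open>-(1 + a\<^sup>2) u\<^sup>2 / 4 = -(cos \<theta>) a u\<^sup>2 / 2\<close>, whose coefficient \<open>cos \<theta> a\<close> lies within
  distance \<open>1\<close> of \<open>1\<close>, inside the disc where the binomial series converges.
\<close>
lemma hermite_kernel_at_saddle: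
  fixes \<theta> u :: real and n :: nat
  assumes "n > 0"
  defines "x \<equiv> sqrt (2 * real n) * sin \<theta>"
  shows "hermite_kernel x n (sqrt (real n / 2) * cos \<theta> + u / 2) =
           of_real (sqrt (real n / 2) ^ n * exp (- (real n / 2 * cos \<theta> ^ 2)))
           * cis (real n * (1 / 2 * sin (2 * \<theta>) + \<theta> - pi / 2))
           * saddle_factor (cis (- \<theta>)) (u / sqrt (2 * real n)) ^ n"
proof -
  define r where "r = sqrt (real n / 2)"
  define h where "h = u / sqrt (2 * real n)"
  define t where "t = r * cos \<theta> + u / 2"
  have r: "r > 0" "r ^ 2 = real n / 2" "sqrt (2 * real n) = 2 * r"
    using assms(1) by (auto simp: r_def real_sqrt_divide real_sqrt_mult field_simps)
  have u: "u = 2 * r * h" using r by (simp add: h_def)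
  have x: "x = 2 * r * sin \<theta>" by (simp add: x_def r)
  have base: "Complex (x / 2) (- t) = of_real r * cis (\<theta> - pi / 2) * (1 + cis (- \<theta>) * of_real h)"
    by (simp add: complex_eq_iff t_def x u cos_diff sin_diff algebra_simps)
       (simp flip: distrib_left power2_eq_square add: sin_squared_eq)
  have ex: "exp (Complex (- (t ^ 2)) (x * t)) =
      of_real (exp (- (real n / 2 * cos \<theta> ^ 2))) * cis (real n * (1 / 2 * sin (2 * \<theta>)))
       * exp (- (cis (- \<theta>) * of_real h) - of_real (h ^ 2 / 2)) ^ n"
  proof -
    have "Complex (- (t ^ 2)) (x * t) = of_real (- (r ^ 2 * cos \<theta> ^ 2)) + \<i> * of_real (r ^ 2 * sin (2 * \<theta>))
        + of_real (2 * r ^ 2) * (- (cis (- \<theta>) * of_real h) - of_real (h ^ 2 / 2))"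
      unfolding sin_double by (simp add: complex_eq_iff t_def x u power2_eq_square algebra_simps)
    also have "\<dots> = of_real (- (real n / 2 * cos \<theta> ^ 2)) + \<i> * of_real (real n * (1 / 2 * sin (2 * \<theta>)))
        + of_nat n * (- (cis (- \<theta>) * of_real h) - of_real (h ^ 2 / 2))"
      unfolding r by simp
    finally show ?thesis
      by (simp only: exp_add exp_of_real exp_of_nat_mult cis_conv_exp)
  qed
  have "hermite_kernel x n t = (of_real r ^ n * of_real (exp (- (real n / 2 * cos \<theta> ^ 2))))
        * (cis (\<theta> - pi / 2) ^ n * cis (real n * (1 / 2 * sin (2 * \<theta>))))
        * saddle_factor (cis (- \<theta>)) h ^ n"
    unfolding hermite_kernel_def base ex saddle_factor_def power_mult_distrib by (simp only: mult_ac)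
  also have "cis (\<theta> - pi / 2) ^ n * cis (real n * (1 / 2 * sin (2 * \<theta>)))
      = cis (real n * (1 / 2 * sin (2 * \<theta>) + \<theta> - pi / 2))"
    by (simp only: Complex.DeMoivre cis_mult) (simp add: algebra_simps)
  finally show ?thesis by (simp add: t_def r_def h_def)
qed

text \<open>
  This identity is exact. The amplitude and the phase of the theorem already stand in front of the
  integral as the value of the kernel at the saddle point; only the factor \<open>\<surd>(2 / cos \<theta>)\<close> and
  the phase shift \<open>\<theta>/2\<close> remain to come from the limit of the integral.
\<close>
lemma hermite_saddle_form:
  fixes \<theta> :: real and n :: nat
  assumes "n > 0"
  shows "hermite n (sqrt (2 * real n) * sin \<theta>) =
     exp (real n / 2 * (ln (2 * real n) - cos (2 * \<theta>))) *
     Re (cis (real n * (1 / 2 * sin (2 * \<theta>) + \<theta> - pi / 2)) *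
         (\<integral>u. indicator {- (cos \<theta> * sqrt (2 * real n))..} u *\<^sub>R
             saddle_factor (cis (- \<theta>)) (u / sqrt (2 * real n)) ^ n \<partial>lborel)) / sqrt pi"
proof -
  define r where "r = sqrt (real n / 2)"
  define x where "x = sqrt (2 * real n) * sin \<theta>"
  define A where "A = r ^ n * exp (- (real n / 2 * cos \<theta> ^ 2))"
  define \<omega> where "\<omega> = cis (real n * (1 / 2 * sin (2 * \<theta>) + \<theta> - pi / 2))"
  define J where "J = (\<integral>u. indicator {- (cos \<theta> * sqrt (2 * real n))..} u *\<^sub>R
             saddle_factor (cis (- \<theta>)) (u / sqrt (2 * real n)) ^ n \<partial>lborel)"
  have r: "r > 0" "r ^ 2 = real n / 2" "sqrt (2 * real n) = 2 * r"
    using assms(1) by (auto simp: r_def real_sqrt_divide real_sqrt_mult field_simps)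
  have "(\<integral>t. indicator {0..} t *\<^sub>R hermite_kernel x n t \<partial>lborel)
      = (1 / 2) *\<^sub>R (\<integral>u. indicator {0..} (r * cos \<theta> + 1 / 2 * u) *\<^sub>R hermite_kernel x n (r * cos \<theta> + 1 / 2 * u) \<partial>lborel)"
    by (subst lborel_integral_real_affine[of "1 / 2" _ "r * cos \<theta>"]) auto
  also have "(\<integral>u. indicator {0..} (r * cos \<theta> + 1 / 2 * u) *\<^sub>R hermite_kernel x n (r * cos \<theta> + 1 / 2 * u) \<partial>lborel)
     = (\<integral>u. (of_real A * \<omega>) * (indicator {- (cos \<theta> * sqrt (2 * real n))..} u *\<^sub>R
             saddle_factor (cis (- \<theta>)) (u / sqrt (2 * real n)) ^ n) \<partial>lborel)"
  proof (rule Bochner_Integration.integral_cong[OF refl])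
    fix u :: real
    have "indicator {0..} (r * cos \<theta> + 1 / 2 * u) = (indicator {- (cos \<theta> * sqrt (2 * real n))..} u :: real)"
      unfolding r(3) by (auto simp: indicator_def algebra_simps)
    thus "indicator {0..} (r * cos \<theta> + 1 / 2 * u) *\<^sub>R hermite_kernel x n (r * cos \<theta> + 1 / 2 * u)
       = (of_real A * \<omega>) * (indicator {- (cos \<theta> * sqrt (2 * real n))..} u *\<^sub>R
             saddle_factor (cis (- \<theta>)) (u / sqrt (2 * real n)) ^ n)"
      using hermite_kernel_at_saddle[OF assms, of \<theta> u] by (simp add: A_def \<omega>_def x_def r_def)
  qed
  also have "\<dots> = of_real A * \<omega> * J" unfolding J_def by (rule integral_mult_right_zero)
  finally have half: "(\<integral>t. indicator {0..} t *\<^sub>R hermite_kernel x n t \<partial>lborel) = (1 / 2) *\<^sub>R (of_real A * \<omega> * J)" .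
  have "complex_of_real (hermite n x) = of_real (2 ^ n * (exp (x ^ 2 / 4) / sqrt pi) * (A * Re (\<omega> * J)))"
    unfolding hermite_integral_representation integral_hermite_kernel_half_line half by (simp add: mult.assoc)
  hence "hermite n x = (2 ^ n * exp (x ^ 2 / 4) * A) * Re (\<omega> * J) / sqrt pi"
    unfolding of_real_eq_iff by simp
  also have "2 ^ n * exp (x ^ 2 / 4) * A = (2 * r) ^ n * exp (- (real n / 2) * cos (2 * \<theta>))"
  proof -
    have "x ^ 2 / 4 = real n / 2 * sin \<theta> ^ 2" by (simp add: x_def power_mult_distrib)
    hence "exp (x ^ 2 / 4) * exp (- (real n / 2 * cos \<theta> ^ 2)) = exp (- (real n / 2) * cos (2 * \<theta>))"
      unfolding cos_double by (simp add: mult_exp_exp algebra_simps)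
    thus ?thesis unfolding A_def power_mult_distrib by simp
  qed
  also have "(2 * r) ^ n = exp (real n / 2 * ln (2 * real n))"
  proof -
    have "2 * r = exp (ln (2 * real n) / 2)"
      using assms unfolding r(3)[symmetric] by (simp flip: ln_sqrt)
    thus ?thesis by (simp flip: exp_of_nat_mult)
  qed
  finally show ?thesis
    by (simp add: x_def \<omega>_def J_def mult_exp_exp algebra_simps)
qed

theorem theorem5:
  fixes \<theta> :: real
  assumes "- pi / 2 < \<theta>" and "\<theta> < pi / 2"
  shows "(\<lambda>n. hermite n (sqrt (2 * real n) * sin \<theta>)
           - sqrt (2 / cos \<theta>) * exp (real n / 2 * (ln (2 * real n) - cos (2 * \<theta>)))
             * cos (real n * (1 / 2 * sin (2 * \<theta>) + \<theta> - pi / 2) + \<theta> / 2))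
         \<in> o(\<lambda>n. sqrt (2 / cos \<theta>) * exp (real n / 2 * (ln (2 * real n) - cos (2 * \<theta>))))"
proof (rule smalloI_tendsto)
  \<comment> \<open>\<open>J n\<close> tends to \<open>L\<close> without a rate. That is enough: the oscillating factor \<open>\<omega> n\<close> has modulus one,
    so the error relative to the amplitude is at most a constant times \<open>norm (J n - L)\<close>.\<close>
  define E where "E n = exp (real n / 2 * (ln (2 * real n) - cos (2 * \<theta>)))" for n
  define \<omega> where "\<omega> n = cis (real n * (1 / 2 * sin (2 * \<theta>) + \<theta> - pi / 2))" for n
  define J where "J n = (\<integral>u. indicator {- (cos \<theta> * sqrt (2 * real n))..} u *\<^sub>R
             saddle_factor (cis (- \<theta>)) (u / sqrt (2 * real n)) ^ n \<partial>lborel)" for n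
  define L where "L = of_real (sqrt (2 * pi / cos \<theta>)) * cis (\<theta> / 2)"
  define K where "K = sqrt pi * sqrt (2 / cos \<theta>)"
  have c: "cos \<theta> > 0" using assms by (intro cos_gt_zero_pi) auto
  have K: "K > 0" using c by (simp add: K_def)
  have "of_real (sqrt (2 * pi)) * (of_real (cos \<theta>) * cis (- \<theta>)) powr (- 1 / 2) = L"
  proof -
    have Ln: "Ln (of_real (cos \<theta>) * cis (- \<theta>)) = of_real (ln (cos \<theta>)) - \<i> * of_real \<theta>"
    proof (rule Ln_unique)
      show "exp (of_real (ln (cos \<theta>)) - \<i> * of_real \<theta>) = of_real (cos \<theta>) * cis (- \<theta>)"
        using c by (simp add: exp_diff exp_of_real cis_conv_exp exp_minus field_simps)
    qed (use assms pi_gt_zero in auto)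
    have "of_real (cos \<theta>) * cis (- \<theta>) \<noteq> 0" using c by simp
    hence "(of_real (cos \<theta>) * cis (- \<theta>)) powr (- 1 / 2)
        = exp (- 1 / 2 * (of_real (ln (cos \<theta>)) - \<i> * of_real \<theta>))"
      by (simp only: powr_def Ln if_False)
    also have "\<dots> = exp (of_real (- ln (cos \<theta>) / 2) + \<i> * of_real (\<theta> / 2))"
      by (simp add: algebra_simps)
    also have "\<dots> = of_real (exp (- ln (cos \<theta>) / 2)) * cis (\<theta> / 2)"
      by (simp only: exp_add exp_of_real cis_conv_exp)
    also have "exp (- ln (cos \<theta>) / 2) = 1 / sqrt (cos \<theta>)"
      using c by (simp add: exp_minus field_simps flip: ln_sqrt)
    finally show ?thesis by (simp add: L_def real_sqrt_divide)
  qed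
  hence J: "J \<longlonglongrightarrow> L"
    using laplace_saddle_integral[of "cis (- \<theta>)"] c by (simp add: J_def[abs_def])
  have "(\<lambda>n. Re (\<omega> n * (J n - L)) / K) \<longlonglongrightarrow> 0"
  proof (rule Lim_null_comparison)
    show "(\<lambda>n. norm (J n - L) / K) \<longlonglongrightarrow> 0"
      using tendsto_norm_zero[OF Lim_null[THEN iffD1, OF J]] by (rule tendsto_divide_zero)
    show "eventually (\<lambda>n. norm (Re (\<omega> n * (J n - L)) / K) \<le> norm (J n - L) / K) sequentially"
    proof (intro always_eventually allI)
      fix n
      have "\<bar>Re (\<omega> n * (J n - L))\<bar> \<le> norm (J n - L)"
        using abs_Re_le_cmod[of "\<omega> n * (J n - L)"] by (simp only: norm_mult \<omega>_def norm_cis mult_1)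
      thus "norm (Re (\<omega> n * (J n - L)) / K) \<le> norm (J n - L) / K"
        using K by (simp add: divide_right_mono del: times_complex.sel)
    qed
  qed
  moreover have "eventually (\<lambda>n. Re (\<omega> n * (J n - L)) / K =
      (hermite n (sqrt (2 * real n) * sin \<theta>)
           - sqrt (2 / cos \<theta>) * E n * cos (real n * (1 / 2 * sin (2 * \<theta>) + \<theta> - pi / 2) + \<theta> / 2))
      / (sqrt (2 / cos \<theta>) * E n)) sequentially"
    using eventually_gt_at_top[of 0]
  proof eventually_elim
    case (elim n)
    let ?\<phi> = "real n * (1 / 2 * sin (2 * \<theta>) + \<theta> - pi / 2)"
    have "Re (\<omega> n * L) = K * cos (?\<phi> + \<theta> / 2)"
    proof -
      have "\<omega> n * L = of_real K * cis (?\<phi> + \<theta> / 2)"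
        by (simp add: \<omega>_def L_def K_def cis_mult real_sqrt_divide real_sqrt_mult mult_ac flip: cis_mult)
      thus ?thesis by simp
    qed
    moreover have "hermite n (sqrt (2 * real n) * sin \<theta>) = E n * Re (\<omega> n * J n) / sqrt pi"
      using hermite_saddle_form[OF elim, of \<theta>] by (simp add: E_def \<omega>_def J_def)
    moreover have "E n > 0" by (simp add: E_def)
    ultimately show ?case using K c
      by (simp add: K_def right_diff_distrib field_simps del: times_complex.sel)
  qed
  ultimately show "(\<lambda>n. (hermite n (sqrt (2 * real n) * sin \<theta>)
           - sqrt (2 / cos \<theta>) * exp (real n / 2 * (ln (2 * real n) - cos (2 * \<theta>)))
             * cos (real n * (1 / 2 * sin (2 * \<theta>) + \<theta> - pi / 2) + \<theta> / 2)) /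
      (sqrt (2 / cos \<theta>) * exp (real n / 2 * (ln (2 * real n) - cos (2 * \<theta>))))) \<longlonglongrightarrow> 0"
    unfolding E_def by (rule Lim_transform_eventually)
  show "eventually (\<lambda>n. sqrt (2 / cos \<theta>) * exp (real n / 2 * (ln (2 * real n) - cos (2 * \<theta>))) \<noteq> 0) sequentially"
    using c by simp
qed

end
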